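(* Let $F_i\colon \mathbb{R}^n\rightrightarrows \mathbb{R}^p$ for $i=1,\ldots,m$ be nearly convex set-valued mappings. Suppose that $$\bigcap_{i=1}^m \mathrm{ri}(\mathrm{gph}\, F_i) \neq \emptyset.$$ Then the set-valued mapping $\bigcap_{i=1}^m F_i$ is nearly convex.
   Context: A set $\Omega\subset\mathbb{R}^k$ is nearly convex if there exists a convex set $C\subset\mathbb{R}^k$ such that $C\subset\Omega\subset\overline{C}$, where $\overline{C}$ is the closure of $C$. For an arbitrary set $\Omega\subset\mathbb{R}^k$, the relative interior is $\mathrm{ri}\,\Omega=\{a\in\Omega \mid \text{there exists } \delta>0 \text{ with } B(a;\delta)\cap \mathrm{aff}\,\Omega\subset\Omega\}$, where $\mathrm{aff}\,\Omega$ is the affine hull and $B(a;\delta)$ the open ball. A set-valued mapping $F\colon\mathbb{R}^n\rightrightarrows\mathbb{R}^p$ assigns to each $x\in\mathbb{R}^n$ a (possibly empty) subset $F(x)\subset\mathbb{R}^p$, and $\mathrm{gph}\,F=\{(x,y)\in\mathbb{R}^n\times\mathbb{R}^p\mid y\in F(x)\}$. $F$ is nearly convex if $\mathrm{gph}\,F$ is a nearly convex set. The intersection mapping is $\big(\bigcap_{i=1}^m F_i\big)(x)=F_1(x)\cap\cdots\cap F_m(x)$ for $x\in\mathbb{R}^n$. *)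

theory Defs
  imports "HOL-Analysis.Analysis"
begin

definition nearly_convex :: "'a::euclidean_space set \<Rightarrow> bool" where
  "nearly_convex \<Omega> \<longleftrightarrow> (\<exists>C. convex C \<and> C \<subseteq> \<Omega> \<and> \<Omega> \<subseteq> closure C)"

(* A set-valued mapping from 'a to 'b is a function F :: 'a => 'b set;
   F x may be empty. *)

definition gph :: "('a \<Rightarrow> 'b set) \<Rightarrow> ('a \<times> 'b) set" where
  "gph F = {(x, y). y \<in> F x}"

definition nearly_convex_map ::
    "('a::euclidean_space \<Rightarrow> 'b::euclidean_space set) \<Rightarrow> bool" where
  "nearly_convex_map F \<longleftrightarrow> nearly_convex (gph F)"

end

(* Sandwiching Omega between a convex C and its closure forces ri Omega to lie in ri C, so the
   convex cores C_i inherit the common relative interior point. For convex sets this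
   qualification makes closure commute with intersection, hence the intersection of
   the C_i is a convex core for the intersection of the graphs. *)
theory Submission
  imports Defs
begin

text \<open>A convex set and its closure have the same relative interior, so it suffices to compare
  \<open>\<Omega>\<close> with \<open>closure C\<close>.\<close>

lemma rel_interior_subset_if_between_closure:
  fixes C :: "'a::euclidean_space set"
  assumes "convex C" "C \<subseteq> \<Omega>" "\<Omega> \<subseteq> closure C"
  shows "rel_interior \<Omega> \<subseteq> rel_interior C"
proof -
  \<comment> \<open>Monotonicity of \<open>rel_interior\<close> can fail when affine hulls differ;
    the sandwich forces them to agree.\<close>
  have "affine hull \<Omega> = affine hull (closure C)"
    using assms(2,3) by (metis closure_same_affine_hull hull_mono subset_antisym)
  then have "rel_interior \<Omega> \<subseteq> rel_interior (closure C)"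
    using assms(3) by (rule subset_rel_interior[rotated])
  then show ?thesis
    using convex_rel_interior_closure[OF assms(1)] by simp
qed

text \<open>\<open>I\<close> may be infinite: from a point of all the \<open>closure (C i)\<close>,
  the open segment to a common relative interior point lies in every \<open>C i\<close>.\<close>

lemma nearly_convex_INT:
  fixes \<Omega> :: "'i \<Rightarrow> 'a::euclidean_space set"
  assumes near: "\<And>i. i \<in> I \<Longrightarrow> nearly_convex (\<Omega> i)"
    and ri: "(\<Inter>i\<in>I. rel_interior (\<Omega> i)) \<noteq> {}"
  shows "nearly_convex (\<Inter>i\<in>I. \<Omega> i)"
proof -
  from near obtain C where C: "\<And>i. i \<in> I \<Longrightarrow> convex (C i) \<and> C i \<subseteq> \<Omega> i \<and> \<Omega> i \<subseteq> closure (C i)"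
    unfolding nearly_convex_def by metis
  have "rel_interior (\<Omega> i) \<subseteq> rel_interior (C i)" if "i \<in> I" for i
    using C[OF that] by (intro rel_interior_subset_if_between_closure) auto
  with ri have "\<Inter>(rel_interior ` C ` I) \<noteq> {}"
    by blast
  then have "closure (\<Inter>(C ` I)) = \<Inter>(closure ` C ` I)"
    using C by (intro closure_Inter_convex) auto
  then have "\<Inter>(\<Omega> ` I) \<subseteq> closure (\<Inter>(C ` I))"
    using C by blast
  moreover have "\<Inter>(C ` I) \<subseteq> \<Inter>(\<Omega> ` I)"
    using C by blast
  moreover have "convex (\<Inter>(C ` I))"
    using C by (intro convex_Inter) auto
  ultimately show ?thesis
    unfolding nearly_convex_def by blast
qed

theorem theorem4p9:
  fixes F :: "nat \<Rightarrow> real ^ 'n \<Rightarrow> (real ^ 'p) set" and m :: nat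
  assumes "m \<ge> 1"
    and "\<And>i. i \<in> {1..m} \<Longrightarrow> nearly_convex_map (F i)"
    and "(\<Inter>i\<in>{1..m}. rel_interior (gph (F i))) \<noteq> {}"
  shows "nearly_convex_map (\<lambda>x. \<Inter>i\<in>{1..m}. F i x)"
proof -
  \<comment> \<open>Passing to graphs commutes with pointwise intersection, so the claim reduces to
    sets.\<close>
  have "gph (\<lambda>x. \<Inter>i\<in>{1..m}. F i x) = (\<Inter>i\<in>{1..m}. gph (F i))"
    by (auto simp: gph_def)
  then show ?thesis
    using nearly_convex_INT[of "{1..m}" "\<lambda>i. gph (F i)"] assms(2,3)
    by (simp add: nearly_convex_map_def)
qed

end
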